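(* In the two-party computation (2PC) setup with additive secret shares, the cosine function can be computed with two online rounds of communication. That is, there is a 2PC protocol using two online rounds of communication such that, for every $x \in \mathbb{R}$ and every additive sharing $x = [x]_1 + [x]_2$ in which server$_1$ initially holds only $[x]_1$ and server$_2$ initially holds only $[x]_2$, at the end of the protocol server$_1$ holds a value $[z]_1$ and server$_2$ holds a value $[z]_2$ with $[z]_1 + [z]_2 = \cos(x)$.
   Context: **Two-party computation (2PC) setup.** There are two non-colluding servers, server$_1$ and server$_2$. A secret value $y$ is stored as additive secret shares: server$_i$ holds a share $[y]_i$ ($i=1,2$), with $[y]_1 + [y]_2 = y$. Inputs, all intermediate results, and outputs are held as secret shares, and the guarantee of the setup is that neither server learns anything about the secret values from the computation. Arithmetic is idealized as exact arithmetic on real numbers. **Protocols.** A 2PC protocol is a finite sequence of steps, each of which is of one of the following kinds. - Local computation: each server applies any function to the values it currently holds. This uses no communication. - Secure addition or subtraction: given shares of $a$ and $b$, the servers obtain shares of $a \pm b$. This requires no online rounds. - Secure exchange: for a value $a$ known to one server in the clear, that server creates additive shares $[a]_1, [a]_2$ by the standard additive secret sharing mechanism, keeps its own share and sends the other share to the other server. This requires one online round. - Secure multiplication (the known protocol based on Beaver triplets): given shares of $a$ and $b$, the servers obtain shares of $ab$. This requires one online round. The Beaver triplets are input-independent and are prepared in an offline phase. **Online rounds.** The number of rounds is the number of times the parties need to communicate or synchronize with each other. Offline rounds are input-independent, can be performed in advance, and are not counted. Online rounds are input-dependent and must be performed synchronously during the computation. Several exchanges (in either direction), or several multiplications, that do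 not depend on one another's results can be performed in parallel in the same online round. *)

theory Defs
  imports Complex_Main
begin

datatype server = Server1 | Server2

text \<open>
  The values a server holds form a list that only grows. Every step appends equally many values
  at both servers, so that the values at a common position \<open>k\<close> can be read as an additive sharing,
  by \<open>st Server1 ! k\<close> and \<open>st Server2 ! k\<close>, of their sum. A value known to one server in the clear is
  an entry of that server's list alone.
\<close>

type_synonym state = "server \<Rightarrow> real list"

definition initial_state :: "real \<Rightarrow> real \<Rightarrow> state" where
  "initial_state x1 x2 = (\<lambda>p. case p of Server1 \<Rightarrow> [x1] | Server2 \<Rightarrow> [x2])"

text \<open>
  One element of \<open>Exchanges\<close> or \<open>Multiplications\<close> is a batch of operations performed in parallel, in
  a single online round. A batch consists of exchanges only or of multiplications only. In
  \<open>Exchanges\<close>, a pair \<open>(s, i)\<close> means that server \<open>s\<close> shares out the value it holds at position \<open>i\<close>. In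
  \<open>Local f g\<close> the function \<open>f\<close> is applied by the first server and \<open>g\<close> by the second one, each to
  everything that this server holds.
\<close>

datatype step =
    Local "real list \<Rightarrow> real" "real list \<Rightarrow> real"
  | Add nat nat
  | Sub nat nat
  | Exchanges "(server \<times> nat) list"
  | Multiplications "(nat \<times> nat) list"

type_synonym protocol = "step list"

fun online_rounds_step :: "step \<Rightarrow> nat" where
  "online_rounds_step (Local f g) = 0"
| "online_rounds_step (Add i j) = 0"
| "online_rounds_step (Sub i j) = 0"
| "online_rounds_step (Exchanges es) = 1"
| "online_rounds_step (Multiplications ms) = 1"

definition online_rounds :: "protocol \<Rightarrow> nat" where
  "online_rounds P = sum_list (map online_rounds_step P)"

fun new_values :: "step \<Rightarrow> nat" where
  "new_values (Local f g) = 1"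
| "new_values (Add i j) = 1"
| "new_values (Sub i j) = 1"
| "new_values (Exchanges es) = length es"
| "new_values (Multiplications ms) = length ms"

text \<open>
  \<open>n\<close> is the number of values held before the step. The operands of a batch have to be held before
  the batch starts, so its operations do not depend on one another's results.
\<close>

fun well_formed_step :: "nat \<Rightarrow> step \<Rightarrow> bool" where
  "well_formed_step n (Local f g) \<longleftrightarrow> True"
| "well_formed_step n (Add i j) \<longleftrightarrow> i < n \<and> j < n"
| "well_formed_step n (Sub i j) \<longleftrightarrow> i < n \<and> j < n"
| "well_formed_step n (Exchanges es) \<longleftrightarrow> es \<noteq> [] \<and> (\<forall>(s, i) \<in> set es. i < n)"
| "well_formed_step n (Multiplications ms) \<longleftrightarrow> ms \<noteq> [] \<and> (\<forall>(i, j) \<in> set ms. i < n \<and> j < n)"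

fun well_formed_from :: "nat \<Rightarrow> protocol \<Rightarrow> bool" where
  "well_formed_from n [] \<longleftrightarrow> True"
| "well_formed_from n (a # P) \<longleftrightarrow> well_formed_step n a \<and> well_formed_from (n + new_values a) P"

text \<open>Each server starts with one value, its share of the input.\<close>

definition well_formed :: "protocol \<Rightarrow> bool" where
  "well_formed P \<longleftrightarrow> well_formed_from 1 P"

definition values_held :: "protocol \<Rightarrow> nat" where
  "values_held P = 1 + sum_list (map new_values P)"

text \<open>
  Server \<open>s\<close> shares out \<open>a\<close>, choosing \<open>r\<close> as the share it keeps.
\<close>

definition share_out :: "real \<Rightarrow> server \<Rightarrow> real \<Rightarrow> server \<Rightarrow> real" where
  "share_out r s a = (\<lambda>p. if p = s then r else a - r)"

record beaver_triple =
  fst_factor :: "server \<Rightarrow> real"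
  snd_factor :: "server \<Rightarrow> real"
  prod_share :: "server \<Rightarrow> real"

definition valid_triple :: "beaver_triple \<Rightarrow> bool" where
  "valid_triple t \<longleftrightarrow>
     prod_share t Server1 + prod_share t Server2 =
     (fst_factor t Server1 + fst_factor t Server2) * (snd_factor t Server1 + snd_factor t Server2)"

text \<open>
  The value that becomes public when each server sends its share of \<open>a - u\<close> to the other one.
\<close>

definition opened_value :: "(server \<Rightarrow> real) \<Rightarrow> (server \<Rightarrow> real) \<Rightarrow> real" where
  "opened_value a u = (a Server1 - u Server1) + (a Server2 - u Server2)"

text \<open>
  Beaver's protocol: with \<open>d = a - u\<close> and \<open>e = b - v\<close> opened simultaneously,
  \<open>a b = u v + d v + e u + d e\<close>; the public summand \<open>d e\<close> is added by the first server.
\<close>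

definition beaver_mult ::
  "beaver_triple \<Rightarrow> (server \<Rightarrow> real) \<Rightarrow> (server \<Rightarrow> real) \<Rightarrow> server \<Rightarrow> real" where
  "beaver_mult t a b = (\<lambda>p.
     let d = opened_value a (fst_factor t); e = opened_value b (snd_factor t)
     in prod_share t p + d * snd_factor t p + e * fst_factor t p
        + (if p = Server1 then d * e else 0))"

text \<open>
  \<open>T\<close> is the material prepared offline and \<open>r\<close> the randomness of the exchanges; both are indexed by
  the position of the value being produced, so nothing is used twice.
\<close>

fun run_step :: "(nat \<Rightarrow> beaver_triple) \<Rightarrow> (nat \<Rightarrow> real) \<Rightarrow> step \<Rightarrow> state \<Rightarrow> state" where
  "run_step T r (Local f g) st =
     (\<lambda>p. st p @ [case p of Server1 \<Rightarrow> f (st p) | Server2 \<Rightarrow> g (st p)])"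
| "run_step T r (Add i j) st = (\<lambda>p. st p @ [st p ! i + st p ! j])"
| "run_step T r (Sub i j) st = (\<lambda>p. st p @ [st p ! i - st p ! j])"
| "run_step T r (Exchanges es) st =
     (\<lambda>p. st p @ map (\<lambda>(k, s, i). share_out (r k) s (st s ! i) p) (enumerate (length (st p)) es))"
| "run_step T r (Multiplications ms) st =
     (\<lambda>p. st p @ map (\<lambda>(k, i, j). beaver_mult (T k) (\<lambda>q. st q ! i) (\<lambda>q. st q ! j) p)
                     (enumerate (length (st p)) ms))"

fun run :: "(nat \<Rightarrow> beaver_triple) \<Rightarrow> (nat \<Rightarrow> real) \<Rightarrow> protocol \<Rightarrow> state \<Rightarrow> state" where
  "run T r [] st = st"
| "run T r (a # P) st = run T r P (run_step T r a st)"

lemma length_run_step: "length (run_step T r a st p) = length (st p) + new_values a"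
  by (cases a) auto

lemma length_run: "length (run T r P st p) = length (st p) + sum_list (map new_values P)"
  by (induction P arbitrary: st) (auto simp: length_run_step)

lemma share_out_correct: "share_out r s a Server1 + share_out r s a Server2 = a"
  by (cases s) (auto simp: share_out_def)

lemma beaver_mult_correct:
  assumes "valid_triple t"
  shows "beaver_mult t a b Server1 + beaver_mult t a b Server2 =
         (a Server1 + a Server2) * (b Server1 + b Server2)"
  using assms by (auto simp: beaver_mult_def valid_triple_def opened_value_def Let_def algebra_simps)

lemma run_step_cong:
  assumes "\<And>q k. length (st q) \<le> k \<Longrightarrow> T k = T' k \<and> r k = r' k"
  shows "run_step T r a st = run_step T' r' a st"
  using assms by (cases a) (fastforce simp: in_set_enumerate_eq)+

lemma run_cong:
  assumes "\<And>q k. length (st q) \<le> k \<Longrightarrow> T k = T' k \<and> r k = r' k"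
  shows "run T r P st = run T' r' P st"
  using assms
proof (induction P arbitrary: st)
  case (Cons a P)
  have "run_step T r a st = run_step T' r' a st"
    using Cons.prems by (rule run_step_cong)
  moreover have "run T r P (run_step T' r' a st) = run T' r' P (run_step T' r' a st)"
    by (rule Cons.IH) (metis Cons.prems length_run_step add_leD1)
  ultimately show ?case by simp
qed simp

text \<open>
  Besides the values it holds, server \<open>p\<close> sees its own shares of the triples and the openings.
\<close>

fun openings_step :: "(nat \<Rightarrow> beaver_triple) \<Rightarrow> step \<Rightarrow> state \<Rightarrow> server \<Rightarrow> (real \<times> real) list" where
  "openings_step T (Multiplications ms) st p =
     map (\<lambda>(k, i, j). (opened_value (\<lambda>q. st q ! i) (fst_factor (T k)),
                       opened_value (\<lambda>q. st q ! j) (snd_factor (T k))))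
         (enumerate (length (st p)) ms)"
| "openings_step T a st p = []"

fun openings :: "(nat \<Rightarrow> beaver_triple) \<Rightarrow> (nat \<Rightarrow> real) \<Rightarrow> protocol \<Rightarrow> state \<Rightarrow> server \<Rightarrow> (real \<times> real) list" where
  "openings T r [] st p = []"
| "openings T r (a # P) st p = openings_step T a st p @ openings T r P (run_step T r a st) p"

lemma openings_step_cong:
  assumes "\<And>k. length (st p) \<le> k \<Longrightarrow> T k = T' k"
  shows "openings_step T a st p = openings_step T' a st p"
  using assms by (cases a) (fastforce simp: in_set_enumerate_eq)+

lemma openings_cong:
  assumes "\<And>q k. length (st q) \<le> k \<Longrightarrow> T k = T' k \<and> r k = r' k"
  shows "openings T r P st p = openings T' r' P st p"
  using assms
proof (induction P arbitrary: st)
  case (Cons a P)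
  have "run_step T r a st = run_step T' r' a st"
    using Cons.prems by (rule run_step_cong)
  moreover have "openings T r P (run_step T' r' a st) p = openings T' r' P (run_step T' r' a st) p"
    by (rule Cons.IH) (metis Cons.prems length_run_step add_leD1)
  moreover have "openings_step T a st p = openings_step T' a st p"
    using Cons.prems by (intro openings_step_cong) auto
  ultimately show ?case by simp
qed simp

definition same_own_shares :: "server \<Rightarrow> beaver_triple \<Rightarrow> beaver_triple \<Rightarrow> bool" where
  "same_own_shares p t t' \<longleftrightarrow> fst_factor t p = fst_factor t' p \<and>
     snd_factor t p = snd_factor t' p \<and> prod_share t p = prod_share t' p"

lemma beaver_mult_private:
  assumes "valid_triple t" "a p = a' p" "b p = b' p"
  shows "\<exists>t'. valid_triple t' \<and> same_own_shares p t t' \<and>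
    opened_value a' (fst_factor t') = opened_value a (fst_factor t) \<and>
    opened_value b' (snd_factor t') = opened_value b (snd_factor t) \<and>
    beaver_mult t' a' b' p = beaver_mult t a b p"
proof -
  define u where "u = (\<lambda>q. fst_factor t q + a' q - a q)"
  define v where "v = (\<lambda>q. snd_factor t q + b' q - b q)"
  define w where "w = (\<lambda>q. if q = p then prod_share t p
    else (u Server1 + u Server2) * (v Server1 + v Server2) - prod_share t p)"
  let ?t = "\<lparr>fst_factor = u, snd_factor = v, prod_share = w\<rparr>"
  have "valid_triple ?t"
    by (cases p) (auto simp: valid_triple_def w_def)
  moreover have "same_own_shares p t ?t"
    using assms by (auto simp: same_own_shares_def u_def v_def w_def)
  moreover have "opened_value a' (fst_factor ?t) = opened_value a (fst_factor t)"
    "opened_value b' (snd_factor ?t) = opened_value b (snd_factor t)"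
    by (auto simp: opened_value_def u_def v_def)
  ultimately show ?thesis
    by (intro exI[of _ ?t]) (simp add: beaver_mult_def same_own_shares_def)
qed

lemma run_step_private:
  assumes "\<And>k. valid_triple (T k)" and "st p = st' p"
  shows "\<exists>T' r'. (\<forall>k. valid_triple (T' k) \<and> same_own_shares p (T k) (T' k)) \<and>
    run_step T' r' a st' p = run_step T r a st p \<and>
    openings_step T' a st' p = openings_step T a st p"
proof (cases a)
  case (Exchanges es)
  let ?n = "length (st p)"
  define r' where "r' = (\<lambda>k. case es ! (k - ?n) of (s, i) \<Rightarrow>
    if s = p then r k else st' s ! i - st s ! i + r k)"
  have "run_step T r' a st' p = run_step T r a st p"
    using assms(2) by (auto simp: Exchanges in_set_enumerate_eq r'_def share_out_def)
  then show ?thesis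
    using assms(1) by (intro exI[of _ T] exI[of _ r']) (auto simp: Exchanges same_own_shares_def)
next
  case (Multiplications ms)
  let ?n = "length (st p)"
  let ?a = "\<lambda>st k q. st q ! fst (ms ! (k - ?n))" and ?b = "\<lambda>st k q. st q ! snd (ms ! (k - ?n))"
  have "\<forall>k. \<exists>t'. valid_triple t' \<and> same_own_shares p (T k) t' \<and>
    opened_value (?a st' k) (fst_factor t') = opened_value (?a st k) (fst_factor (T k)) \<and>
    opened_value (?b st' k) (snd_factor t') = opened_value (?b st k) (snd_factor (T k)) \<and>
    beaver_mult t' (?a st' k) (?b st' k) p = beaver_mult (T k) (?a st k) (?b st k) p"
    using assms by (intro allI beaver_mult_private) auto
  then obtain T' where T': "\<forall>k. valid_triple (T' k) \<and> same_own_shares p (T k) (T' k) \<and>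
    opened_value (?a st' k) (fst_factor (T' k)) = opened_value (?a st k) (fst_factor (T k)) \<and>
    opened_value (?b st' k) (snd_factor (T' k)) = opened_value (?b st k) (snd_factor (T k)) \<and>
    beaver_mult (T' k) (?a st' k) (?b st' k) p = beaver_mult (T k) (?a st k) (?b st k) p"
    by metis
  have "run_step T' r a st' p = run_step T r a st p"
    using assms(2) T' by (auto simp: Multiplications in_set_enumerate_eq)
      (metis fst_conv snd_conv)
  moreover have "openings_step T' a st' p = openings_step T a st p"
    using assms(2) T' by (auto simp: Multiplications in_set_enumerate_eq)
      (metis fst_conv snd_conv)+
  ultimately show ?thesis
    using T' by blast
qed (use assms in \<open>auto intro!: exI[of _ T] simp: same_own_shares_def split: server.splits\<close>)

lemma run_private:
  assumes "\<And>k. valid_triple (T k)" and "st p = st' p"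
    and "\<And>q. length (st q) = n" and "\<And>q. length (st' q) = n"
  shows "\<exists>T' r'. (\<forall>k. valid_triple (T' k) \<and> same_own_shares p (T k) (T' k)) \<and>
    run T' r' P st' p = run T r P st p \<and> openings T' r' P st' p = openings T r P st p"
  using assms(2-)
proof (induction P arbitrary: st st' n)
  case Nil
  then show ?case
    using assms(1) by (auto intro!: exI[of _ T] simp: same_own_shares_def)
next
  case (Cons a P)
  obtain T1 r1 where 1: "\<forall>k. valid_triple (T1 k) \<and> same_own_shares p (T k) (T1 k)"
    "run_step T1 r1 a st' p = run_step T r a st p"
    "openings_step T1 a st' p = openings_step T a st p"
    using run_step_private[of T st p st' a r] assms(1) Cons.prems(1) by metis
  let ?n = "n + new_values a" and ?st = "run_step T r a st" and ?st' = "run_step T1 r1 a st'"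
  obtain T2 r2 where 2: "\<forall>k. valid_triple (T2 k) \<and> same_own_shares p (T k) (T2 k)"
    "run T2 r2 P ?st' p = run T r P ?st p" "openings T2 r2 P ?st' p = openings T r P ?st p"
    using Cons.IH[of ?st ?st' ?n] 1(2) Cons.prems(2,3) by (auto simp: length_run_step)
  define T' where "T' = (\<lambda>k. if k < ?n then T1 k else T2 k)"
  define r' where "r' = (\<lambda>k. if k < ?n then r1 k else r2 k)"
  have step: "run_step T' r' a st' = ?st'" "openings_step T' a st' p = openings_step T1 a st' p"
    using Cons.prems(3)
    by (cases a; fastforce simp: in_set_enumerate_eq T'_def r'_def)+
  have "run T' r' P ?st' = run T2 r2 P ?st'" "openings T' r' P ?st' p = openings T2 r2 P ?st' p"
    using Cons.prems(3)
    by (intro run_cong openings_cong; auto simp: T'_def r'_def length_run_step)+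
  then show ?case
    using 1 2 step by (intro exI[of _ T'] exI[of _ r']) (auto simp: T'_def)
qed

text \<open>
  No server learns anything about the other server's input: everything it sees is equally possible
  with any other input of the other server. This is the possibilistic form of the guarantee; there
  is no uniform distribution on the reals to draw the shares from.
\<close>

theorem privacy:
  assumes "\<And>k. valid_triple (T k)" and "initial_state x1 x2 p = initial_state y1 y2 p"
  shows "\<exists>T' r'. (\<forall>k. valid_triple (T' k) \<and> same_own_shares p (T k) (T' k)) \<and>
    run T' r' P (initial_state y1 y2) p = run T r P (initial_state x1 x2) p \<and>
    openings T' r' P (initial_state y1 y2) p = openings T r P (initial_state x1 x2) p"
  using assms by (intro run_private[where n = 1]) (auto simp: initial_state_def split: server.split)

end

(* By the addition theorem cos (x1 + x2) = cos x1 * cos x2 - sin x1 * sin x2, where each factor is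
   known in the clear to one server. One round shares out the four factors, a second round forms
   both products, and the subtraction is free. *)
theory Submission
  imports Defs
begin

text \<open>Position 0 is the input share. Positions 1 and 2 hold each server's own cosine and sine
  in the clear, 3 to 6 their sharings, 7 and 8 the two products, 9 the result.\<close>

definition cos_protocol :: protocol where
  "cos_protocol =
     [Local (\<lambda>vs. cos (vs ! 0)) (\<lambda>vs. cos (vs ! 0)),
      Local (\<lambda>vs. sin (vs ! 0)) (\<lambda>vs. sin (vs ! 0)),
      Exchanges [(Server1, 1), (Server2, 1), (Server1, 2), (Server2, 2)],
      Multiplications [(3, 4), (5, 6)],
      Sub 7 8]"

lemma run_cos_protocol:
  "run T r cos_protocol (initial_state x1 x2) p ! 9 =
     beaver_mult (T 7) (share_out (r 3) Server1 (cos x1)) (share_out (r 4) Server2 (cos x2)) p -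
     beaver_mult (T 8) (share_out (r 5) Server1 (sin x1)) (share_out (r 6) Server2 (sin x2)) p"
proof -
  \<comment> \<open>With the case distinction inside the list, lengths and positions evaluate for a
    symbolic \<open>p\<close>.\<close>
  have "initial_state x1 x2 = (\<lambda>p. [case p of Server1 \<Rightarrow> x1 | Server2 \<Rightarrow> x2])"
    by (auto simp: initial_state_def split: server.split)
  then show ?thesis
    by (simp add: cos_protocol_def numeral_eq_Suc)
qed

lemma cos_protocol_correct:
  assumes "\<And>k. valid_triple (T k)"
  shows "run T r cos_protocol (initial_state x1 x2) Server1 ! 9 +
         run T r cos_protocol (initial_state x1 x2) Server2 ! 9 = cos (x1 + x2)"
proof -
  let ?c = "beaver_mult (T 7) (share_out (r 3) Server1 (cos x1)) (share_out (r 4) Server2 (cos x2))"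
  let ?s = "beaver_mult (T 8) (share_out (r 5) Server1 (sin x1)) (share_out (r 6) Server2 (sin x2))"
  have "?c Server1 + ?c Server2 = cos x1 * cos x2" "?s Server1 + ?s Server2 = sin x1 * sin x2"
    \<comment> \<open>Both product sharings reconstruct whatever \<open>r\<close> and
      \<open>T\<close> are, as the masks cancel in the sums.\<close>
    by (simp_all only: beaver_mult_correct[OF assms] share_out_correct)
  then show ?thesis
    by (simp add: run_cos_protocol cos_add)
qed

theorem theorem1:
  "\<exists>(P :: protocol) (out :: nat).
     well_formed P \<and> out < values_held P \<and> online_rounds P = 2 \<and>
     (\<forall>(T :: nat \<Rightarrow> beaver_triple) (r :: nat \<Rightarrow> real) (x :: real) (x1 :: real) (x2 :: real).
        (\<forall>k. valid_triple (T k)) \<longrightarrow> x = x1 + x2 \<longrightarrow>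
        (let final = run T r P (initial_state x1 x2);
             z1 = final Server1 ! out;
             z2 = final Server2 ! out
         in z1 + z2 = cos x))"
proof (intro exI conjI)
  \<comment> \<open>Position 9 is the last of the 1 + 1 + 1 + 4 + 2 + 1 values.\<close>
  show "well_formed cos_protocol" "9 < values_held cos_protocol" "online_rounds cos_protocol = 2"
    by (simp_all add: cos_protocol_def well_formed_def values_held_def online_rounds_def)
qed (simp add: Let_def cos_protocol_correct)

end
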